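(* Let $\sigma>0$, $B_{max}>0$, $\overline P_{12}\ge0$, $\delta\in(0,1)$, $T_f>0$ be given, let $\delta':=\delta/2$ and $\sigma_c:=\sqrt2\,\sigma$, and let $X_c^{\pi'},X_d^{\pi'}$ be the processes defined in the context. Let $\beta\ge0$ be such that $\mathbb P\big[\sup_{t\in[0,T_f]}|X_d^{\pi'}(t)|\ge\beta\big]<\delta/2$. Suppose $(\alpha_c,N_c)$ solves the problem $$\min_{\alpha,N}\ N\quad\text{subject to } N\ge0,\ 0\le\alpha\le1,\quad \mathbb P\Big[\sup_{t\in[0,T_f]}X_c^{\pi'}(t)\ge 2NB_{max}-\beta\Big]+\mathbb P\Big[\inf_{t\in[0,T_f]}X_c^{\pi'}(t)\le\beta\Big]\le\delta'.$$ Then $$N_c\le\frac{\sqrt{8\sigma_c^2T_f\ln(2/\delta')}}{2B_{max}}+\frac{\beta}{B_{max}},\qquad \alpha_c=\frac12.$$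
   Context: $W_1,W_2$ are independent standard one-dimensional Wiener processes on a probability space $(\Omega,\mathcal F,\mathbb P)$. $N$ is a real variable. For given $N$ and $\alpha$, the processes $X_1^{\pi'},X_2^{\pi'}$ (energies in the batteries of two connected microgrids) satisfy, for $t\in[0,T_f]$, $$X_1^{\pi'}(t)=\alpha NB_{max}+\sigma W_1(t)-\int_0^t\tilde P_{12}(s)\,ds,\qquad X_2^{\pi'}(t)=\alpha NB_{max}+\sigma W_2(t)+\int_0^t\tilde P_{12}(s)\,ds,$$ where $\tilde P_{12}(t)=\overline P_{12}$ if $X_1^{\pi'}(t)>X_2^{\pi'}(t)$, $\tilde P_{12}(t)=-\overline P_{12}$ if $X_1^{\pi'}(t)<X_2^{\pi'}(t)$, and $\tilde P_{12}(t)=0$ if $X_1^{\pi'}(t)=X_2^{\pi'}(t)$. Further, $X_c^{\pi'}(t):=X_1^{\pi'}(t)+X_2^{\pi'}(t)=2\alpha NB_{max}+\sigma(W_1(t)+W_2(t))$ and $X_d^{\pi'}(t):=X_2^{\pi'}(t)-X_1^{\pi'}(t)=\sigma(W_2(t)-W_1(t))+2\int_0^t\tilde P_{12}(s)\,ds$; the law of $X_d^{\pi'}$ does not depend on $N,\alpha$. *)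

theory Defs
  imports "HOL-Probability.Probability"
begin

text \<open>
  Paths are continuous for every outcome, so that suprema and infima over compact time
  intervals are finite and measurable without assuming the probability space complete.
\<close>

definition wiener_process :: "'a measure \<Rightarrow> (real \<Rightarrow> 'a \<Rightarrow> real) \<Rightarrow> bool" where
  "wiener_process M W \<longleftrightarrow>
     prob_space M \<and>
     (\<forall>t\<ge>0. W t \<in> borel_measurable M) \<and>
     (AE \<omega> in M. W 0 \<omega> = 0) \<and>
     (\<forall>\<omega>\<in>space M. continuous_on {0..} (\<lambda>t. W t \<omega>)) \<and>
     (\<forall>s t. 0 \<le> s \<and> s < t \<longrightarrow>
        distributed M lborel (\<lambda>\<omega>. W t \<omega> - W s \<omega>) (normal_density 0 (sqrt (t - s)))) \<and>
     (\<forall>(n::nat) (t::nat \<Rightarrow> real). 0 \<le> t 0 \<and> (\<forall>i<n. t i \<le> t (Suc i)) \<longrightarrow>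
        prob_space.indep_vars M (\<lambda>_. borel) (\<lambda>i \<omega>. W (t (Suc i)) \<omega> - W (t i) \<omega>) {..<n})"

definition indep_processes ::
    "'a measure \<Rightarrow> (real \<Rightarrow> 'a \<Rightarrow> real) \<Rightarrow> (real \<Rightarrow> 'a \<Rightarrow> real) \<Rightarrow> bool" where
  "indep_processes M V W \<longleftrightarrow>
     prob_space.indep_var M
       (PiM {0..} (\<lambda>_. borel)) (\<lambda>\<omega>. \<lambda>t\<in>{0..}. V t \<omega>)
       (PiM {0..} (\<lambda>_. borel)) (\<lambda>\<omega>. \<lambda>t\<in>{0..}. W t \<omega>)"

definition power_flow :: "real \<Rightarrow> real \<Rightarrow> real \<Rightarrow> real" where
  "power_flow P x1 x2 = (if x1 > x2 then P else if x1 < x2 then - P else 0)"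

text \<open>
  The integral equations hold almost surely, simultaneously for all times: because of the
  discontinuous drift, they can fail to be solvable for exceptional noise paths.
\<close>

definition microgrid_energies ::
    "'a measure \<Rightarrow> real \<Rightarrow> real \<Rightarrow> real \<Rightarrow> real \<Rightarrow> (real \<Rightarrow> 'a \<Rightarrow> real) \<Rightarrow> (real \<Rightarrow> 'a \<Rightarrow> real) \<Rightarrow>
     real \<Rightarrow> real \<Rightarrow> (real \<Rightarrow> 'a \<Rightarrow> real) \<Rightarrow> (real \<Rightarrow> 'a \<Rightarrow> real) \<Rightarrow> bool" where
  "microgrid_energies M \<sigma> Bmax P12 Tf W1 W2 N \<alpha> X1 X2 \<longleftrightarrow>
     (\<forall>t\<in>{0..Tf}. X1 t \<in> borel_measurable M \<and> X2 t \<in> borel_measurable M) \<and>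
     (\<forall>\<omega>\<in>space M. continuous_on {0..Tf} (\<lambda>t. X1 t \<omega>) \<and> continuous_on {0..Tf} (\<lambda>t. X2 t \<omega>)) \<and>
     (AE \<omega> in M. \<forall>t\<in>{0..Tf}.
        X1 t \<omega> = \<alpha> * N * Bmax + \<sigma> * W1 t \<omega> - (LBINT s:{0..t}. power_flow P12 (X1 s \<omega>) (X2 s \<omega>)) \<and>
        X2 t \<omega> = \<alpha> * N * Bmax + \<sigma> * W2 t \<omega> + (LBINT s:{0..t}. power_flow P12 (X1 s \<omega>) (X2 s \<omega>)))"

definition total_energy ::
    "(real \<Rightarrow> 'a \<Rightarrow> real) \<Rightarrow> (real \<Rightarrow> 'a \<Rightarrow> real) \<Rightarrow> real \<Rightarrow> 'a \<Rightarrow> real" where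
  "total_energy X1 X2 t \<omega> = X1 t \<omega> + X2 t \<omega>"

definition energy_difference ::
    "(real \<Rightarrow> 'a \<Rightarrow> real) \<Rightarrow> (real \<Rightarrow> 'a \<Rightarrow> real) \<Rightarrow> real \<Rightarrow> 'a \<Rightarrow> real" where
  "energy_difference X1 X2 t \<omega> = X2 t \<omega> - X1 t \<omega>"

text \<open>Here \<open>Xc N \<alpha>\<close> is the total energy process belonging to the decision variables \<open>N\<close>, \<open>\<alpha>\<close>.\<close>

definition feasible ::
    "'a measure \<Rightarrow> real \<Rightarrow> real \<Rightarrow> real \<Rightarrow> real \<Rightarrow> (real \<Rightarrow> real \<Rightarrow> real \<Rightarrow> 'a \<Rightarrow> real) \<Rightarrow>
     real \<times> real \<Rightarrow> bool" where
  "feasible M Bmax Tf \<beta> \<delta>' Xc = (\<lambda>(\<alpha>, N).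
     N \<ge> 0 \<and> 0 \<le> \<alpha> \<and> \<alpha> \<le> 1 \<and>
     \<P>(\<omega> in M. (SUP t\<in>{0..Tf}. Xc N \<alpha> t \<omega>) \<ge> 2 * N * Bmax - \<beta>) +
     \<P>(\<omega> in M. (INF t\<in>{0..Tf}. Xc N \<alpha> t \<omega>) \<le> \<beta>) \<le> \<delta>')"

end

(* The total energy is 2 alpha N Bmax plus sqrt 2 sigma times the Wiener process (W1 + W2) / sqrt 2.
   By the reflection principle its running maximum, and by symmetry minus its running minimum, exceeds
   u > 0 with probability 2 Q (u / v), where Q is the standard normal tail and v = sqrt 2 sigma sqrt Tf.
   The constraint therefore reads 2 Q (a / v) + 2 Q (b / v) <= delta' with a + b = 2 (N Bmax - beta).
   Strict convexity of Q on the positive half-line forces a = b, i.e. alpha = 1 / 2, at an optimum,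
   and Q x <= exp (- x^2 / 2) / 2 shows that the claimed bound on N is attained by a feasible point. *)

theory Submission
  imports Defs "HOL-Real_Asymp.Real_Asymp"
begin

section \<open>The standard normal tail\<close>

text \<open>The strong Markov property at a hitting time is avoided: the reflection principle is
  derived from finite walks. A first passage at time k is decided by the steps before k, and the
  remaining increment is independent of it with median 0. This gives one inequality outright. The
  other is spoiled by the overshoot at first passage, so the final level is raised by a fixed amount
  e, at the price of the probability that some step has size at least e. For a Wiener process the
  grid is refined while the level y is kept away from x, and continuity of Q then lets y tend to x.
  In the sum of the two energies the power flow cancels, so the law of the total energy is explicit.
  A term of the constraint equals 1 when its margin a or b is not positive; since \<delta>' < 1,
  both margins lie where Q is strictly convex. At a = b the constraint reads 4 Q(a / v) \<le>
  \<delta>', and 4 Q(r) \<le> 2 exp(- r^2 / 2), whose right side is \<delta>' at r = sqrt(2 ln(2 /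
  \<delta>')): this is where the logarithm comes from.\<close>

definition normal_tail :: "real \<Rightarrow> real" where
  "normal_tail x = (LBINT t:{x..}. std_normal_density t)"

lemma set_integrable_std_normal_density: "A \<in> sets borel \<Longrightarrow> set_integrable lborel A std_normal_density"
  unfolding set_integrable_def by (intro integrable_mult_indicator) auto

text \<open>Passes from the Lebesgue tail to a gauge integral over a compact interval, the form to
  which the fundamental theorem of calculus applies.\<close>

lemma normal_tail_diff:
  assumes "a \<le> b"
  shows "normal_tail a - normal_tail b = integral {a..b} std_normal_density"
proof -
  have "normal_tail a = integral {a..} std_normal_density" "normal_tail b = integral {b..} std_normal_density"
    unfolding normal_tail_def
    by (intro set_borel_integral_eq_integral set_integrable_std_normal_density; simp)+
  moreover have "integral ({a..b} \<union> {b..}) std_normal_density =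
      integral {a..b} std_normal_density + integral {b..} std_normal_density"
  proof (rule Henstock_Kurzweil_Integration.integral_Un)
    show "negligible ({a..b} \<inter> {b..})"
      by (rule negligible_subset[of "{b}"]) auto
  qed (intro set_borel_integral_eq_integral set_integrable_std_normal_density; simp)+
  moreover have "{a..b} \<union> {b..} = {a..}" using assms by auto
  ultimately show ?thesis by simp
qed

lemma normal_tail_nonneg: "0 \<le> normal_tail x"
  unfolding normal_tail_def set_lebesgue_integral_def by (intro Bochner_Integration.integral_nonneg) auto

text \<open>Near x the tail is a constant minus an integral with variable upper end. The base point
  \<open>x-1\<close> only serves to make x an interior point.\<close>

lemma normal_tail_DERIV: "(normal_tail has_real_derivative - std_normal_density x) (at x)"
proof -
  have "((\<lambda>y. integral {x-1..y} std_normal_density) has_real_derivative std_normal_density x)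
      (at x within {x-1..x+1})"
    by (rule integral_has_real_derivative)
      (auto simp: normal_density_def intro!: continuous_intros)
  then have "((\<lambda>y. integral {x-1..y} std_normal_density) has_real_derivative std_normal_density x) (at x)"
    by (simp add: at_within_Icc_at)
  then have "((\<lambda>y. normal_tail (x-1) - integral {x-1..y} std_normal_density)
      has_real_derivative 0 - std_normal_density x) (at x)"
    by (intro derivative_intros)
  then have "((\<lambda>y. normal_tail (x-1) - integral {x-1..y} std_normal_density)
      has_real_derivative - std_normal_density x) (at x)" by simp
  then show ?thesis
  proof (rule has_field_derivative_transform_within_open[where S="{x-1<..}"])
    show "normal_tail (x-1) - integral {x-1..y} std_normal_density = normal_tail y"
      if "y \<in> {x-1<..}" for y
      using that normal_tail_diff[of "x-1" y] by simp
  qed auto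
qed

lemma isCont_normal_tail: "isCont normal_tail x"
  using normal_tail_DERIV by (rule DERIV_isCont)

text \<open>The density decreases strictly on the nonnegative half-line, so by the mean value
  theorem the tail drops more over the left half of the interval than over the right half.\<close>

lemma normal_tail_strict_midpoint_convex:
  assumes "0 \<le> a" "a < b"
  shows "2 * normal_tail ((a + b) / 2) < normal_tail a + normal_tail b"
proof -
  let ?m = "(a + b) / 2"
  obtain \<xi> where \<xi>: "a < \<xi>" "\<xi> < ?m"
    and eq1: "normal_tail ?m - normal_tail a = (?m - a) * (- std_normal_density \<xi>)"
    using MVT2[of a ?m normal_tail "\<lambda>x. - std_normal_density x"] normal_tail_DERIV assms by auto
  obtain \<eta> where \<eta>: "?m < \<eta>" "\<eta> < b"
    and eq2: "normal_tail b - normal_tail ?m = (b - ?m) * (- std_normal_density \<eta>)"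
    using MVT2[of ?m b normal_tail "\<lambda>x. - std_normal_density x"] normal_tail_DERIV assms by auto
  have "\<xi>\<^sup>2 < \<eta>\<^sup>2" using \<xi> \<eta> assms by (intro power_strict_mono) auto
  then have "std_normal_density \<eta> < std_normal_density \<xi>"
    by (simp add: std_normal_density_def divide_strict_right_mono)
  then have "(b - a) / 2 * std_normal_density \<eta> < (b - a) / 2 * std_normal_density \<xi>"
    using assms by (intro mult_strict_left_mono) auto
  moreover have m: "?m - a = (b - a) / 2" "b - ?m = (b - a) / 2" by (auto simp: field_simps)
  ultimately show ?thesis using eq1 eq2 unfolding m mult_minus_right by argo
qed

text \<open>The two closed half-lines have equal mass by symmetry of the density and overlap only in
  a null set.\<close>

lemma normal_tail_0: "normal_tail 0 = 1 / 2"
proof -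
  let ?\<phi> = std_normal_density
  have int: "integrable lborel (\<lambda>x. indicator A x * ?\<phi> x)" if "A \<in> sets borel" for A
    using set_integrable_std_normal_density[OF that] by (simp add: set_integrable_def)
  have "normal_tail 0 = (\<integral>x. indicator {0..} x * ?\<phi> x \<partial>lborel)"
    by (simp add: normal_tail_def set_lebesgue_integral_def)
  moreover have "\<dots> = (\<integral>x. indicator {..0} x * ?\<phi> x \<partial>lborel)"
    by (subst lborel_integral_real_affine[where c="-1" and t=0])
      (auto simp: normal_density_def indicator_def intro!: Bochner_Integration.integral_cong)
  moreover have "(\<integral>x. indicator {0..} x * ?\<phi> x \<partial>lborel) + (\<integral>x. indicator {..0} x * ?\<phi> x \<partial>lborel)
      = (\<integral>x. indicator {0..} x * ?\<phi> x + indicator {..0} x * ?\<phi> x \<partial>lborel)"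
    by (intro Bochner_Integration.integral_add[symmetric] int) auto
  moreover have "\<dots> = (\<integral>x. ?\<phi> x \<partial>lborel)"
  proof (rule integral_cong_AE)
    have "AE x in lborel. x \<noteq> (0::real)" by (rule AE_lborel_singleton)
    then show "AE x in lborel. indicator {0..} x * ?\<phi> x + indicator {..0} x * ?\<phi> x = ?\<phi> x"
      by eventually_elim (auto simp: indicator_def)
  qed auto
  ultimately show ?thesis by simp
qed

text \<open>After the shift t = x + u the inequality (x + u)^2 \<ge> x^2 + u^2 splits off the
  exponential, and the remaining integral is the tail at 0. The factor 1/2 it contributes is what
  makes the logarithm in the final bound ln(2 / \<delta>') instead of ln(4 / \<delta>').\<close>

lemma normal_tail_le_exp:
  assumes "0 \<le> x"
  shows "normal_tail x \<le> exp (- x\<^sup>2 / 2) / 2"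
proof -
  let ?\<phi> = std_normal_density
  have int: "integrable lborel (\<lambda>x. indicator A x * ?\<phi> x)" if "A \<in> sets borel" for A
    using set_integrable_std_normal_density[OF that] by (simp add: set_integrable_def)
  have "normal_tail x = (\<integral>t. indicator {x..} t * ?\<phi> t \<partial>lborel)"
    by (simp add: normal_tail_def set_lebesgue_integral_def)
  also have "\<dots> = (\<integral>u. indicator {x..} (x + 1 * u) * ?\<phi> (x + 1 * u) \<partial>lborel)"
    by (subst lborel_integral_real_affine[where c=1 and t=x]) auto
  also have "\<dots> \<le> (\<integral>u. exp (- x\<^sup>2 / 2) * (indicator {0..} u * ?\<phi> u) \<partial>lborel)"
  proof (rule integral_mono)
    show "integrable lborel (\<lambda>u. indicator {x..} (x + 1 * u) * ?\<phi> (x + 1 * u))"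
      using lborel_integrable_real_affine[OF int[of "{x..}"], of 1 x] by simp
    show "integrable lborel (\<lambda>u. exp (- x\<^sup>2 / 2) * (indicator {0..} u * ?\<phi> u))"
      by (intro integrable_mult_right int) auto
    fix u :: real
    have "?\<phi> (x + u) \<le> exp (- x\<^sup>2 / 2) * ?\<phi> u" if "0 \<le> u"
    proof -
      have "0 \<le> x * u" using that assms by simp
      then have "- (x + u)\<^sup>2 / 2 \<le> - x\<^sup>2 / 2 + - u\<^sup>2 / 2"
        by (simp add: power2_eq_square field_simps)
      then have "exp (- (x + u)\<^sup>2 / 2) \<le> exp (- x\<^sup>2 / 2) * exp (- u\<^sup>2 / 2)"
        unfolding exp_add[symmetric] by (subst exp_le_cancel_iff)
      then show ?thesis by (simp add: std_normal_density_def divide_right_mono)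
    qed
    then show "indicator {x..} (x + 1 * u) * ?\<phi> (x + 1 * u) \<le>
        exp (- x\<^sup>2 / 2) * (indicator {0..} u * ?\<phi> u)"
      by (auto simp: indicator_def)
  qed
  also have "\<dots> = exp (- x\<^sup>2 / 2) * normal_tail 0"
    by (simp add: normal_tail_def set_lebesgue_integral_def)
  finally show ?thesis by (simp add: normal_tail_0)
qed

section \<open>Tail probabilities of centred normal variables\<close>

context prob_space
begin

lemma prob_ge_std_normal:
  assumes "distributed M lborel Y std_normal_density"
  shows "\<P>(\<omega> in M. y \<le> Y \<omega>) = normal_tail y"
proof -
  have "emeasure M (Y -` {y..} \<inter> space M) =
      (\<integral>\<^sup>+t. ennreal (std_normal_density t) * indicator {y..} t \<partial>lborel)"
    using assms by (rule distributed_emeasure) simp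
  also have "\<dots> = (\<integral>\<^sup>+t. ennreal (indicator {y..} t * std_normal_density t) \<partial>lborel)"
    by (intro nn_integral_cong) (auto simp: indicator_def)
  also have "\<dots> = ennreal (normal_tail y)"
    unfolding normal_tail_def set_lebesgue_integral_def
    using set_integrable_std_normal_density[of "{y..}"]
    by (subst nn_integral_eq_integral) (auto simp: set_integrable_def)
  finally have "measure M (Y -` {y..} \<inter> space M) = normal_tail y"
    by (simp add: measure_def normal_tail_nonneg)
  moreover have "Y -` {y..} \<inter> space M = {\<omega>\<in>space M. y \<le> Y \<omega>}" by auto
  ultimately show ?thesis by simp
qed

lemma prob_ge_normal:
  assumes "distributed M lborel X (normal_density 0 s)" "0 < s"
  shows "\<P>(\<omega> in M. x \<le> X \<omega>) = normal_tail (x / s)"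
proof -
  have "distributed M lborel (\<lambda>\<omega>. (X \<omega> - 0) / s) std_normal_density"
    using assms normal_standard_normal_convert by blast
  then have "\<P>(\<omega> in M. x / s \<le> (X \<omega> - 0) / s) = normal_tail (x / s)"
    by (rule prob_ge_std_normal)
  then show ?thesis using assms by (simp add: divide_le_cancel)
qed

lemma distributed_normal_uminus:
  assumes "distributed M lborel X (normal_density 0 s)" "0 < s"
  shows "distributed M lborel (\<lambda>\<omega>. - X \<omega>) (normal_density 0 s)"
  using normal_density_affine[OF assms, of "-1" 0] by simp

lemma prob_gt_0_normal:
  assumes X: "distributed M lborel X (normal_density 0 s)" and s: "0 < s"
  shows "\<P>(\<omega> in M. 0 < X \<omega>) = 1 / 2"
proof -
  have [measurable]: "X \<in> borel_measurable M" using distributed_measurable[OF X] by simp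
  have "\<P>(\<omega> in M. 0 < X \<omega>) = \<P>(\<omega> in M. \<not> 0 \<le> - X \<omega>)" by (simp add: not_le)
  also have "\<dots> = 1 - \<P>(\<omega> in M. 0 \<le> - X \<omega>)" by (intro prob_neg) measurable
  finally show ?thesis
    using prob_ge_normal[OF distributed_normal_uminus[OF X s] s, of 0] by (simp add: normal_tail_0)
qed

text \<open>Two tails, each with the factor 1/2 of \<open>normal_tail_le_exp\<close>, add up to
  prefactor 1. The bound will control the largest step of a grid walk.\<close>

lemma prob_abs_ge_normal_le:
  assumes X: "distributed M lborel X (normal_density 0 s)" and "0 < s" "0 \<le> x"
  shows "\<P>(\<omega> in M. x \<le> \<bar>X \<omega>\<bar>) \<le> exp (- (x / s)\<^sup>2 / 2)"
proof -
  have [measurable]: "X \<in> borel_measurable M" using distributed_measurable[OF X] by simp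
  have "\<P>(\<omega> in M. x \<le> \<bar>X \<omega>\<bar>) \<le> \<P>(\<omega> in M. x \<le> X \<omega>) + \<P>(\<omega> in M. x \<le> - X \<omega>)"
    by (rule order_trans[OF finite_measure_mono measure_Un_le]) (auto simp: abs_real_def)
  also have "\<dots> = 2 * normal_tail (x / s)"
    using prob_ge_normal[OF X] prob_ge_normal[OF distributed_normal_uminus[OF X]] assms by simp
  also have "\<dots> \<le> exp (- (x / s)\<^sup>2 / 2)"
    using normal_tail_le_exp[of "x / s"] assms by simp
  finally show ?thesis .
qed

end

section \<open>Maxima of symmetric random walks\<close>

text \<open>Symmetry is asked of the remainders only, as a weak inequality from below and a strict
  one from above. In this form it also covers the empty remainder k = n, which is identically 0, as
  well as continuous centred laws.\<close>

locale symmetric_walk = prob_space +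
  fixes X :: "nat \<Rightarrow> 'a \<Rightarrow> real" and n :: nat
  assumes indep_steps: "indep_vars (\<lambda>_. borel) X {..<n}"
    and prob_remainder_ge: "\<And>k. k \<le> n \<Longrightarrow> 1 / 2 \<le> \<P>(\<omega> in M. 0 \<le> (\<Sum>i\<in>{k..<n}. X i \<omega>))"
    and prob_remainder_gt: "\<And>k. k \<le> n \<Longrightarrow> \<P>(\<omega> in M. 0 < (\<Sum>i\<in>{k..<n}. X i \<omega>)) \<le> 1 / 2"
begin

definition walk :: "nat \<Rightarrow> 'a \<Rightarrow> real" where
  "walk k \<omega> = (\<Sum>i<k. X i \<omega>)"

lemma measurable_step: "k < n \<Longrightarrow> X k \<in> borel_measurable M"
  using indep_steps by (auto simp: indep_vars_def)

lemma measurable_walk: "k \<le> n \<Longrightarrow> walk k \<in> borel_measurable M"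
  unfolding walk_def[abs_def] by (intro borel_measurable_sum measurable_step) auto

lemma remainder_eq: "k \<le> n \<Longrightarrow> (\<Sum>i\<in>{k..<n}. X i \<omega>) = walk n \<omega> - walk k \<omega>"
  using sum.atLeastLessThan_concat[of 0 k n "\<lambda>i. X i \<omega>"] by (simp add: walk_def lessThan_atLeast0)

definition first_passage :: "real \<Rightarrow> nat \<Rightarrow> 'a set" where
  "first_passage x k = {\<omega>\<in>space M. x \<le> walk k \<omega> \<and> (\<forall>j<k. walk j \<omega> < x)}"

text \<open>The first passage event is a function of the steps in \<open>{..<k}\<close> and the
  remainder one of the steps in \<open>{k..<n}\<close>; independence of the two blocks gives the
  product. This replaces the Markov property at the passage time.\<close>

lemma prob_first_passage_Int:
  assumes "k \<le> n" "B \<in> sets borel"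
  shows "first_passage x k \<in> events"
    and "prob (first_passage x k \<inter> {\<omega>\<in>space M. walk n \<omega> - walk k \<omega> \<in> B}) =
      prob (first_passage x k) * \<P>(\<omega> in M. walk n \<omega> - walk k \<omega> \<in> B)"
proof -
  let ?N = "\<lambda>I. PiM I (\<lambda>_. borel :: real measure)" and ?X = "\<lambda>I \<omega>. \<lambda>i\<in>I. X i \<omega>"
  let ?P = "{f\<in>space (?N {..<k}). x \<le> sum f {..<k} \<and> (\<forall>j\<in>{..<k}. sum f {..<j} < x)}"
    and ?Q = "{f\<in>space (?N {k..<n}). sum f {k..<n} \<in> B}"
  have meas [measurable]: "(\<lambda>f. sum f J) \<in> borel_measurable (?N I)" if "J \<subseteq> I" for I J :: "nat set"
    using that by (intro borel_measurable_sum measurable_component_singleton) auto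
  have P: "?P \<in> sets (?N {..<k})"
    by (intro sets.sets_Collect_conj sets.sets_Collect_finite_All borel_measurable_le
        borel_measurable_less meas) auto
  have Q: "?Q \<in> sets (?N {k..<n})"
    using measurable_sets[OF meas[OF order_refl] assms(2)] by (simp add: vimage_def Int_def conj_commute)
  have indep: "indep_var (?N {..<k}) (?X {..<k}) (?N {k..<n}) (?X {k..<n})"
    using assms(1) by (intro indep_var_restrict[OF indep_steps]) auto
  have X: "?X {..<k} \<in> measurable M (?N {..<k})" "?X {k..<n} \<in> measurable M (?N {k..<n})"
    using indep by (auto dest: indep_var_rv1 indep_var_rv2)
  have eqP: "?X {..<k} -` ?P \<inter> space M = first_passage x k"
    using measurable_space[OF X(1)] by (auto simp: first_passage_def walk_def)
  have eqQ: "?X {k..<n} -` ?Q \<inter> space M = {\<omega>\<in>space M. walk n \<omega> - walk k \<omega> \<in> B}"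
    using measurable_space[OF X(2)] by (auto simp: remainder_eq[OF assms(1)])
  show "first_passage x k \<in> events"
    unfolding eqP[symmetric] using X(1) P by (rule measurable_sets)
  have "prob ((\<lambda>\<omega>. (?X {..<k} \<omega>, ?X {k..<n} \<omega>)) -` (?P \<times> ?Q) \<inter> space M) =
      prob (?X {..<k} -` ?P \<inter> space M) * prob (?X {k..<n} -` ?Q \<inter> space M)"
    using indep P Q by (rule indep_varD)
  moreover have "(\<lambda>\<omega>. (?X {..<k} \<omega>, ?X {k..<n} \<omega>)) -` (?P \<times> ?Q) \<inter> space M =
      first_passage x k \<inter> {\<omega>\<in>space M. walk n \<omega> - walk k \<omega> \<in> B}"
    unfolding eqP[symmetric] eqQ[symmetric] by auto
  ultimately show "prob (first_passage x k \<inter> {\<omega>\<in>space M. walk n \<omega> - walk k \<omega> \<in> B}) =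
      prob (first_passage x k) * \<P>(\<omega> in M. walk n \<omega> - walk k \<omega> \<in> B)"
    by (simp only: eqP eqQ)
qed

text \<open>The first passage events partition the event that the maximum reaches x. An arbitrary E
  inside it is allowed because events about the final position are decomposed in the same
  way.\<close>

lemma prob_eq_sum_first_passage:
  assumes E: "E \<in> events" "E \<subseteq> {\<omega>\<in>space M. \<exists>k\<le>n. x \<le> walk k \<omega>}"
  shows "prob E = (\<Sum>k\<le>n. prob (E \<inter> first_passage x k))"
proof -
  have "\<exists>k\<le>n. \<omega> \<in> first_passage x k" if mem: "\<omega> \<in> E" for \<omega>
  proof -
    obtain k where k: "k \<le> n" "x \<le> walk k \<omega>" and \<omega>: "\<omega> \<in> space M"
      using subsetD[OF E(2) mem] by blast
    let ?k = "LEAST k. x \<le> walk k \<omega>"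
    have "x \<le> walk ?k \<omega>" "?k \<le> n" using k by (auto intro: LeastI Least_le order_trans)
    moreover have "\<forall>j<?k. walk j \<omega> < x" using not_less_Least not_le by blast
    ultimately show ?thesis using \<omega> by (auto simp: first_passage_def)
  qed
  then have "prob E = prob (\<Union>k\<le>n. E \<inter> first_passage x k)"
    by (intro arg_cong[where f=prob]) blast
  also have "\<dots> = (\<Sum>k\<le>n. prob (E \<inter> first_passage x k))"
  proof (rule finite_measure_finite_Union)
    show "disjoint_family_on (\<lambda>k. E \<inter> first_passage x k) {..n}"
      by (auto simp: disjoint_family_on_def first_passage_def) (metis linorder_neqE_nat not_le)
    show "(\<lambda>k. E \<inter> first_passage x k) ` {..n} \<subseteq> events"
      using E(1) prob_first_passage_Int(1)[of _ "{}" x] by blast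
  qed simp
  finally show ?thesis .
qed

lemma max_event: "{\<omega>\<in>space M. \<exists>k\<le>n. x \<le> walk k \<omega>} \<in> events"
proof -
  have "{\<omega>\<in>space M. x \<le> walk k \<omega>} \<in> events" if "k \<le> n" for k
    using measurable_walk[OF that] by measurable
  then have "(\<Union>k\<le>n. {\<omega>\<in>space M. x \<le> walk k \<omega>}) \<in> events" by (intro sets.finite_UN) auto
  also have "(\<Union>k\<le>n. {\<omega>\<in>space M. x \<le> walk k \<omega>}) = {\<omega>\<in>space M. \<exists>k\<le>n. x \<le> walk k \<omega>}" by auto
  finally show ?thesis .
qed

lemma first_passage_subset: "k \<le> n \<Longrightarrow> first_passage x k \<subseteq> {\<omega>\<in>space M. \<exists>k\<le>n. x \<le> walk k \<omega>}"
  by (auto simp: first_passage_def)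

text \<open>Levy's inequality: once the level is reached, the independent remainder is nonnegative
  with probability at least 1/2, and then the final position is still at least x.\<close>

lemma prob_max_ge_le: "\<P>(\<omega> in M. \<exists>k\<le>n. x \<le> walk k \<omega>) \<le> 2 * \<P>(\<omega> in M. x \<le> walk n \<omega>)"
proof -
  have [measurable]: "walk n \<in> borel_measurable M" by (simp add: measurable_walk)
  let ?E = "{\<omega>\<in>space M. \<exists>k\<le>n. x \<le> walk k \<omega>}" and ?F = "{\<omega>\<in>space M. x \<le> walk n \<omega>}"
  have "prob (?E \<inter> first_passage x k) \<le> 2 * prob (?F \<inter> first_passage x k)" if k: "k \<le> n" for k
  proof -
    have "prob (first_passage x k) * (1 / 2) \<le>
        prob (first_passage x k) * \<P>(\<omega> in M. walk n \<omega> - walk k \<omega> \<in> {0..})"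
      using prob_remainder_ge[OF k] remainder_eq[OF k] by (intro mult_left_mono) auto
    also have "\<dots> = prob (first_passage x k \<inter> {\<omega>\<in>space M. walk n \<omega> - walk k \<omega> \<in> {0..}})"
      using k by (intro prob_first_passage_Int(2)[symmetric]) auto
    also have "\<dots> \<le> prob (?F \<inter> first_passage x k)"
      using prob_first_passage_Int(1)[OF k, of "{}" x]
      by (intro finite_measure_mono) (auto simp: first_passage_def)
    finally show ?thesis using first_passage_subset[OF k, of x] by (simp add: Int_absorb1)
  qed
  then have "(\<Sum>k\<le>n. prob (?E \<inter> first_passage x k)) \<le> (\<Sum>k\<le>n. 2 * prob (?F \<inter> first_passage x k))"
    by (intro sum_mono) auto
  moreover have "prob ?E = (\<Sum>k\<le>n. prob (?E \<inter> first_passage x k))"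
    by (rule prob_eq_sum_first_passage[OF max_event order_refl])
  moreover have "prob ?F = (\<Sum>k\<le>n. prob (?F \<inter> first_passage x k))"
    by (intro prob_eq_sum_first_passage) auto
  ultimately show ?thesis unfolding sum_distrib_left[symmetric] by linarith
qed

text \<open>Unless one of the increments exceeds \<open>e\<close>, the walk overshoots the level \<open>x\<close> by at most \<open>e\<close>
  when it first reaches it.\<close>

lemma prob_max_ge_ge:
  assumes "0 < x" "0 \<le> e"
  shows "2 * \<P>(\<omega> in M. x + e \<le> walk n \<omega>) \<le> \<P>(\<omega> in M. \<exists>k\<le>n. x \<le> walk k \<omega>) +
    2 * \<P>(\<omega> in M. \<exists>k<n. e \<le> \<bar>X k \<omega>\<bar>)"
proof -
  have [measurable]: "walk n \<in> borel_measurable M" by (simp add: measurable_walk)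
  let ?E = "{\<omega>\<in>space M. \<exists>k\<le>n. x \<le> walk k \<omega>}"
    and ?B = "{\<omega>\<in>space M. \<exists>k<n. e \<le> \<bar>X k \<omega>\<bar>}"
  let ?F = "{\<omega>\<in>space M. x + e \<le> walk n \<omega>} - ?B"
  have "{\<omega>\<in>space M. e \<le> \<bar>X k \<omega>\<bar>} \<in> events" if "k < n" for k
    using measurable_step[OF that] by measurable
  then have "(\<Union>k<n. {\<omega>\<in>space M. e \<le> \<bar>X k \<omega>\<bar>}) \<in> events" by (intro sets.finite_UN) auto
  also have "(\<Union>k<n. {\<omega>\<in>space M. e \<le> \<bar>X k \<omega>\<bar>}) = ?B" by auto
  finally have B: "?B \<in> events" .
  have F: "?F \<in> events" using B by (rule sets.Diff[rotated]) measurable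
  have "2 * prob (?F \<inter> first_passage x k) \<le> prob (?E \<inter> first_passage x k)" if k: "k \<le> n" for k
  proof -
    \<comment> \<open>Without a large step the walk is below \<open>x + e\<close> at first passage,
      so ending at \<open>x + e\<close> or higher takes a strictly positive remainder, an event of
      probability at most 1/2.\<close>
    have "?F \<inter> first_passage x k \<subseteq> first_passage x k \<inter> {\<omega>\<in>space M. walk n \<omega> - walk k \<omega> \<in> {0<..}}"
    proof
      fix \<omega> assume \<omega>: "\<omega> \<in> ?F \<inter> first_passage x k"
      \<comment> \<open>The walk starts at 0 < x, so a passage has a last step \<open>j\<close>,
        before which the walk is below x.\<close>
      have "0 < k" using \<omega> \<open>0 < x\<close> by (cases k) (auto simp: first_passage_def walk_def)
      then obtain j where j: "k = Suc j" by (cases k) auto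
      have "\<not> e \<le> \<bar>X j \<omega>\<bar>" "walk j \<omega> < x"
        using \<omega> k j by (auto simp: first_passage_def)
      then have "walk k \<omega> < x + e" using j by (auto simp: walk_def)
      then show "\<omega> \<in> first_passage x k \<inter> {\<omega>\<in>space M. walk n \<omega> - walk k \<omega> \<in> {0<..}}" using \<omega> by auto
    qed
    then have "prob (?F \<inter> first_passage x k) \<le>
        prob (first_passage x k \<inter> {\<omega>\<in>space M. walk n \<omega> - walk k \<omega> \<in> {0<..}})"
      using prob_first_passage_Int(1)[OF k, of "{}" x] measurable_walk[OF k]
      by (intro finite_measure_mono sets.Int) auto
    also have "\<dots> = prob (first_passage x k) * \<P>(\<omega> in M. walk n \<omega> - walk k \<omega> \<in> {0<..})"
      using k by (intro prob_first_passage_Int(2)) auto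
    also have "\<dots> \<le> prob (first_passage x k) * (1 / 2)"
      using prob_remainder_gt[OF k] remainder_eq[OF k] by (intro mult_left_mono) auto
    finally show ?thesis using first_passage_subset[OF k, of x] by (simp add: Int_absorb1)
  qed
  then have "(\<Sum>k\<le>n. 2 * prob (?F \<inter> first_passage x k)) \<le>
      (\<Sum>k\<le>n. prob (?E \<inter> first_passage x k))"
    by (intro sum_mono) auto
  moreover have "prob ?E = (\<Sum>k\<le>n. prob (?E \<inter> first_passage x k))"
    by (rule prob_eq_sum_first_passage[OF max_event order_refl])
  moreover have "prob ?F = (\<Sum>k\<le>n. prob (?F \<inter> first_passage x k))"
  proof (rule prob_eq_sum_first_passage[OF F])
    show "?F \<subseteq> ?E" using \<open>0 \<le> e\<close> by force
  qed
  ultimately have "2 * prob ?F \<le> prob ?E" unfolding sum_distrib_left[symmetric] by linarith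
  moreover have "\<P>(\<omega> in M. x + e \<le> walk n \<omega>) \<le> prob (?F \<union> ?B)"
    by (rule finite_measure_mono[OF _ sets.Un[OF F B]]) blast
  moreover have "prob (?F \<union> ?B) \<le> prob ?F + prob ?B" by (rule measure_Un_le[OF F B])
  ultimately show ?thesis by linarith
qed

end

section \<open>The reflection principle for Wiener processes\<close>

text \<open>The strict inequality leaves room: g stays above y near t, and a fine enough grid has a
  point there.\<close>

lemma continuous_on_dyadic_approx:
  fixes g :: "real \<Rightarrow> real"
  assumes "continuous_on {0..T} g" "0 < T" "t \<in> {0..T}" "y < g t"
  shows "\<exists>m. \<exists>k\<le>2 ^ m. y \<le> g (T * real k / real (2 ^ m))"
proof -
  obtain d where d: "0 < d" "\<And>s. s \<in> {0..T} \<Longrightarrow> dist s t < d \<Longrightarrow> dist (g s) (g t) < g t - y"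
    using assms unfolding continuous_on_iff by (metis diff_gt_0_iff_gt)
  obtain m :: nat where m: "T / d < 2 ^ m" using real_arch_pow[of 2 "T / d"] by auto
  \<comment> \<open>The index of the last grid point not after t, hence at distance less than T /
    2^m from it.\<close>
  define k where "k = nat \<lfloor>t * 2 ^ m / T\<rfloor>"
  have "real k = \<lfloor>t * 2 ^ m / T\<rfloor>" using assms by (simp add: k_def)
  then have k: "real k \<le> t * 2 ^ m / T" "t * 2 ^ m / T < real k + 1" by linarith+
  have "t * 2 ^ m / T \<le> 2 ^ m" using assms by (simp add: field_simps)
  with k(1) have "real k \<le> 2 ^ m" by linarith
  then have "k \<le> 2 ^ m" by (metis of_nat_le_iff of_nat_numeral of_nat_power)
  have le: "T * real k / 2 ^ m \<le> t" using k(1) assms by (simp add: field_simps)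
  have "t < T * real k / 2 ^ m + T / 2 ^ m" using k(2) assms by (simp add: field_simps)
  moreover have "T / 2 ^ m < d" using m d(1) by (simp add: field_simps)
  ultimately have "dist (T * real k / 2 ^ m) t < d" using le by (simp add: dist_real_def)
  moreover have "T * real k / 2 ^ m \<in> {0..T}" using le assms by auto
  ultimately have "dist (g (T * real k / 2 ^ m)) (g t) < g t - y" using d(2) by blast
  then have "y \<le> g (T * real k / real (2 ^ m))" by (simp add: dist_real_def)
  with \<open>k \<le> 2 ^ m\<close> show ?thesis by blast
qed

text \<open>A maximum may be attained off the grid, hence the slack
  \<open>inverse (real (Suc j))\<close>. Compactness gives a maximiser, whose value is at least x in
  the limit. The right-hand side involves countably many times only, which yields measurability of
  the supremum event.\<close>

lemma continuous_on_dyadic_max: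
  fixes g :: "real \<Rightarrow> real"
  assumes g: "continuous_on {0..T} g" and "0 < T"
  shows "(\<exists>t\<in>{0..T}. x \<le> g t) \<longleftrightarrow>
    (\<forall>j. \<exists>m. \<exists>k\<le>2 ^ m. x - inverse (real (Suc j)) \<le> g (T * real k / real (2 ^ m)))"
proof
  assume "\<exists>t\<in>{0..T}. x \<le> g t"
  then obtain t where "t \<in> {0..T}" "x \<le> g t" by auto
  moreover have "x - inverse (real (Suc j)) < x" for j by simp
  ultimately show "\<forall>j. \<exists>m. \<exists>k\<le>2 ^ m. x - inverse (real (Suc j)) \<le> g (T * real k / real (2 ^ m))"
    using continuous_on_dyadic_approx[OF g \<open>0 < T\<close>] order_less_le_trans by blast
next
  assume approx: "\<forall>j. \<exists>m. \<exists>k\<le>2 ^ m. x - inverse (real (Suc j)) \<le> g (T * real k / real (2 ^ m))"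
  obtain t where t: "t \<in> {0..T}" "\<And>s. s \<in> {0..T} \<Longrightarrow> g s \<le> g t"
    using continuous_attains_sup[OF compact_Icc _ g] \<open>0 < T\<close> by force
  have "x - g t \<le> inverse (real (Suc j))" for j
  proof -
    obtain m k where k: "k \<le> 2 ^ m" "x - inverse (real (Suc j)) \<le> g (T * real k / real (2 ^ m))"
      using approx by blast
    have "real k \<le> 2 ^ m" using k(1) by (metis of_nat_le_iff of_nat_numeral of_nat_power)
    then have "T * real k / real (2 ^ m) \<in> {0..T}" using \<open>0 < T\<close> by (simp add: field_simps)
    with k(2) t(2) show ?thesis by force
  qed
  then have "x - g t \<le> 0"
    using LIMSEQ_inverse_real_of_nat by (intro LIMSEQ_le_const) auto
  with t(1) show "\<exists>t\<in>{0..T}. x \<le> g t" by auto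
qed

lemma dyadic_max_event:
  fixes f :: "real \<Rightarrow> 'a \<Rightarrow> real"
  assumes "\<And>t. t \<in> {0..T} \<Longrightarrow> f t \<in> borel_measurable M" "0 < T"
  shows "{\<omega>\<in>space M. \<exists>k\<le>2 ^ m. x \<le> f (T * real k / real (2 ^ m)) \<omega>} \<in> sets M"
proof -
  have "{\<omega>\<in>space M. x \<le> f (T * real k / real (2 ^ m)) \<omega>} \<in> sets M" if "k \<le> 2 ^ m" for k
  proof -
    have "real k \<le> 2 ^ m" using that by (metis of_nat_le_iff of_nat_numeral of_nat_power)
    then have [measurable]: "f (T * real k / real (2 ^ m)) \<in> borel_measurable M"
      using \<open>0 < T\<close> by (intro assms) (simp add: field_simps)
    show ?thesis by measurable
  qed
  then have "(\<Union>k\<in>{..2 ^ m}. {\<omega>\<in>space M. x \<le> f (T * real k / real (2 ^ m)) \<omega>}) \<in> sets M"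
    by (intro sets.finite_UN) auto
  also have "(\<Union>k\<in>{..2 ^ m}. {\<omega>\<in>space M. x \<le> f (T * real k / real (2 ^ m)) \<omega>}) =
      {\<omega>\<in>space M. \<exists>k\<le>2 ^ m. x \<le> f (T * real k / real (2 ^ m)) \<omega>}" by auto
  finally show ?thesis .
qed

lemma path_exceeds_event:
  fixes f :: "real \<Rightarrow> 'a \<Rightarrow> real"
  assumes f: "\<And>t. t \<in> {0..T} \<Longrightarrow> f t \<in> borel_measurable M"
    and cont: "\<And>\<omega>. \<omega> \<in> space M \<Longrightarrow> continuous_on {0..T} (\<lambda>t. f t \<omega>)" and T: "0 < T"
  shows "{\<omega>\<in>space M. \<exists>t\<in>{0..T}. x \<le> f t \<omega>} \<in> sets M"
proof -
  have "(\<Inter>j. \<Union>m. {\<omega>\<in>space M. \<exists>k\<le>2 ^ m. x - inverse (real (Suc j)) \<le> f (T * real k / real (2 ^ m)) \<omega>})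
      \<in> sets M"
    by (rule sets.countable_INT, rule image_subsetI, rule sets.countable_UN, rule image_subsetI)
      (rule dyadic_max_event[OF f T], simp_all)
  also have "(\<Inter>j. \<Union>m. {\<omega>\<in>space M. \<exists>k\<le>2 ^ m. x - inverse (real (Suc j)) \<le> f (T * real k / real (2 ^ m)) \<omega>})
      = {\<omega>\<in>space M. \<forall>j. \<exists>m. \<exists>k\<le>2 ^ m. x - inverse (real (Suc j)) \<le> f (T * real k / real (2 ^ m)) \<omega>}"
    by auto
  also have "\<dots> = {\<omega>\<in>space M. \<exists>t\<in>{0..T}. x \<le> f t \<omega>}"
    using continuous_on_dyadic_max[OF cont T, of _ x] by (intro Collect_cong conj_cong refl) (rule sym)
  finally show ?thesis .
qed

section \<open>Wiener processes along a grid and in the limit\<close>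

lemma wiener_measurable: "wiener_process M W \<Longrightarrow> 0 \<le> t \<Longrightarrow> W t \<in> borel_measurable M"
  unfolding wiener_process_def by blast

lemma wiener_continuous:
  "wiener_process M W \<Longrightarrow> \<omega> \<in> space M \<Longrightarrow> continuous_on {0..} (\<lambda>t. W t \<omega>)"
  unfolding wiener_process_def by blast

lemma wiener_increment_distributed:
  assumes "wiener_process M W" "0 \<le> s" "s < t"
  shows "distributed M lborel (\<lambda>\<omega>. W t \<omega> - W s \<omega>) (normal_density 0 (sqrt (t - s)))"
  using assms unfolding wiener_process_def by blast

lemma wiener_grid_walk:
  assumes W: "wiener_process M W" and "0 < T" "0 < n"
  shows "symmetric_walk M (\<lambda>i \<omega>. W (T * real (Suc i) / real n) \<omega> - W (T * real i / real n) \<omega>) n"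
proof -
  interpret prob_space M using W by (simp add: wiener_process_def)
  define t where "t i = T * real i / real n" for i
  have t: "0 \<le> t 0" "\<And>i. t i \<le> t (Suc i)"
    using assms by (auto simp: t_def field_simps)
  have sum: "(\<Sum>i\<in>{k..<n}. W (t (Suc i)) \<omega> - W (t i) \<omega>) = W (t n) \<omega> - W (t k) \<omega>"
    if "k \<le> n" for k \<omega>
    using that by (rule sum_Suc_diff')
  have normal: "distributed M lborel (\<lambda>\<omega>. W (t n) \<omega> - W (t k) \<omega>) (normal_density 0 (sqrt (t n - t k)))"
    "0 < sqrt (t n - t k)" if "k < n" for k
  proof -
    have "0 \<le> t k" "t k < t n" using that assms by (auto simp: t_def field_simps)
    then show "distributed M lborel (\<lambda>\<omega>. W (t n) \<omega> - W (t k) \<omega>) (normal_density 0 (sqrt (t n - t k)))"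
      "0 < sqrt (t n - t k)"
      using wiener_increment_distributed[OF W] by auto
  qed
  show ?thesis unfolding t_def[symmetric]
  proof
    show "indep_vars (\<lambda>_. borel) (\<lambda>i \<omega>. W (t (Suc i)) \<omega> - W (t i) \<omega>) {..<n}"
      using W t unfolding wiener_process_def by blast
    fix k assume "k \<le> n"
    show "1 / 2 \<le> \<P>(\<omega> in M. 0 \<le> (\<Sum>i\<in>{k..<n}. W (t (Suc i)) \<omega> - W (t i) \<omega>))"
      unfolding sum[OF \<open>k \<le> n\<close>]
      using prob_ge_normal[OF normal, of k 0] \<open>k \<le> n\<close>
      by (cases "k = n") (auto simp: normal_tail_0 prob_space)
    show "\<P>(\<omega> in M. 0 < (\<Sum>i\<in>{k..<n}. W (t (Suc i)) \<omega> - W (t i) \<omega>)) \<le> 1 / 2"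
      unfolding sum[OF \<open>k \<le> n\<close>]
      using prob_gt_0_normal[OF normal, of k] \<open>k \<le> n\<close> by (cases "k = n") auto
  qed
qed

text \<open>The steps telescope. The term \<open>W 0 \<omega>\<close> stays because it vanishes only
  almost surely, while the identity is used for every outcome.\<close>

lemma wiener_walk_eq:
  assumes "symmetric_walk M (\<lambda>i \<omega>. W (T * real (Suc i) / real n) \<omega> - W (T * real i / real n) \<omega>) n"
  shows "symmetric_walk.walk (\<lambda>i \<omega>. W (T * real (Suc i) / real n) \<omega> - W (T * real i / real n) \<omega>) k \<omega>
    = W (T * real k / real n) \<omega> - W 0 \<omega>"
  unfolding symmetric_walk.walk_def[OF assms]
  using sum_lessThan_telescope[of "\<lambda>i. W (T * real i / real n) \<omega>" k] by simp

text \<open>The increments over a grid of mesh \<open>T / n\<close> form a symmetric walk. Its maximum approximates the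
  supremum of the path, and its largest step tends to \<open>0\<close> in probability since \<open>n exp (- c n) \<longlonglongrightarrow> 0\<close>.\<close>

theorem wiener_reflection:
  assumes W: "wiener_process M W" and T: "0 < T" and x: "0 < x"
  shows "\<P>(\<omega> in M. \<exists>t\<in>{0..T}. x \<le> W t \<omega> - W 0 \<omega>) = 2 * normal_tail (x / sqrt T)"
    (is "measure M ?A = _")
proof (rule antisym)
  interpret prob_space M using W by (simp add: wiener_process_def)
  let ?D = "\<lambda>t \<omega>. W t \<omega> - W 0 \<omega>"
  have WT: "distributed M lborel (?D T) (normal_density 0 (sqrt T))"
    using wiener_increment_distributed[OF W, of 0 T] T by simp
  have D: "?D t \<in> borel_measurable M" if "t \<in> {0..T}" for t
    using that by (intro borel_measurable_diff wiener_measurable[OF W]) auto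
  have cont: "continuous_on {0..T} (\<lambda>t. ?D t \<omega>)" if "\<omega> \<in> space M" for \<omega>
    using that by (intro continuous_on_diff continuous_on_const
      continuous_on_subset[OF wiener_continuous[OF W]]) auto
  have A: "?A \<in> events" by (rule path_exceeds_event[OF D cont T])
  have grid: "(\<exists>k\<le>n. y \<le> ?D (T * real k / real n) \<omega>) \<Longrightarrow> (\<exists>t\<in>{0..T}. y \<le> ?D t \<omega>)"
    if "0 < n" for n :: nat and y \<omega>
    using that T by (force simp: field_simps)

  \<comment> \<open>A path that reaches x is certain to reach only lower levels on a dyadic grid,
    hence y < x.\<close>
  have upper: "measure M ?A \<le> 2 * normal_tail (y / sqrt T)" if y: "y < x" for y
  proof -
    let ?E = "\<lambda>m. {\<omega>\<in>space M. \<exists>k\<le>2 ^ m. y \<le> ?D (T * real k / real (2 ^ m)) \<omega>}"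
    have E: "?E m \<in> events" for m by (rule dyadic_max_event[OF D T])
    \<comment> \<open>Dyadic grids are nested, since index k at level m is index 2k at level m + 1;
      so continuity from below applies.\<close>
    have "incseq ?E"
    proof (rule incseq_SucI, clarify)
      fix m \<omega> k assume "k \<le> (2::nat) ^ m" "y \<le> ?D (T * real k / real (2 ^ m)) \<omega>"
      then have "2 * k \<le> 2 ^ Suc m \<and> y \<le> ?D (T * real (2 * k) / real (2 ^ Suc m)) \<omega>" by simp
      then show "\<exists>k\<le>2 ^ Suc m. y \<le> ?D (T * real k / real (2 ^ Suc m)) \<omega>" by blast
    qed
    moreover have range: "range ?E \<subseteq> events" using E by blast
    ultimately have "(\<lambda>m. measure M (?E m)) \<longlonglongrightarrow> measure M (\<Union>m. ?E m)"
      by (intro finite_Lim_measure_incseq)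
    moreover have "measure M (?E m) \<le> 2 * normal_tail (y / sqrt T)" for m
    proof -
      have walk: "symmetric_walk M (\<lambda>i \<omega>. W (T * real (Suc i) / real (2 ^ m)) \<omega> -
          W (T * real i / real (2 ^ m)) \<omega>) (2 ^ m)"
        by (rule wiener_grid_walk[OF W T]) simp
      have "measure M (?E m) \<le> 2 * measure M {\<omega>\<in>space M. y \<le> ?D (T * real (2 ^ m) / real (2 ^ m)) \<omega>}"
        using symmetric_walk.prob_max_ge_le[OF walk, of y] unfolding wiener_walk_eq[OF walk] .
      then show ?thesis using prob_ge_normal[OF WT, of y] T by simp
    qed
    ultimately have "measure M (\<Union>m. ?E m) \<le> 2 * normal_tail (y / sqrt T)"
      by (intro LIMSEQ_le_const2) auto
    moreover have "?A \<subseteq> (\<Union>m. ?E m)"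
    proof
      fix \<omega> assume "\<omega> \<in> ?A"
      then obtain t where "\<omega> \<in> space M" "t \<in> {0..T}" "x \<le> ?D t \<omega>" by auto
      then show "\<omega> \<in> (\<Union>m. ?E m)"
        using continuous_on_dyadic_approx[OF cont T, of \<omega> t y] y by auto
    qed
    then have "measure M ?A \<le> measure M (\<Union>m. ?E m)"
      by (rule finite_measure_mono) (rule sets.countable_UN[OF range])
    ultimately show ?thesis by simp
  qed
  have cts: "isCont (\<lambda>y. 2 * normal_tail (y / sqrt T)) x"
    by (intro continuous_intros isCont_o2[OF _ isCont_normal_tail]) (use T in auto)
  then have "((\<lambda>y. 2 * normal_tail (y / sqrt T)) \<longlongrightarrow> 2 * normal_tail (x / sqrt T)) (at_left x)"
    using filterlim_at_split isContD by blast
  then show "measure M ?A \<le> 2 * normal_tail (x / sqrt T)"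
    by (rule tendsto_lowerbound) (auto simp: upper eventually_at_filter)

  \<comment> \<open>The gap \<open>y - x\<close> is the overshoot allowance, fixed while the mesh
    tends to 0.\<close>
  have lower: "2 * normal_tail (y / sqrt T) \<le> measure M ?A" if y: "x < y" for y
  proof (rule LIMSEQ_le_const)
    \<comment> \<open>An increment has variance T / n, so it is at least \<open>y - x\<close> in
      size with probability at most exp(- c n); the union bound over n increments adds the factor
      n.\<close>
    define c where "c = (y - x)\<^sup>2 / (2 * T)"
    have "0 < c" using y T by (simp add: c_def)
    then have "(\<lambda>n. real n * exp (- c * real n)) \<longlonglongrightarrow> 0" by real_asymp
    then have "(\<lambda>n. measure M ?A + 2 * (real n * exp (- c * real n))) \<longlonglongrightarrow> measure M ?A + 2 * 0"
      by (intro tendsto_intros)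
    then show "(\<lambda>n. measure M ?A + 2 * (real n * exp (- c * real n))) \<longlonglongrightarrow> measure M ?A" by simp
    have "2 * normal_tail (y / sqrt T) \<le> measure M ?A + 2 * (real n * exp (- c * real n))"
      if n: "0 < n" for n
    proof -
      let ?X = "\<lambda>i \<omega>. W (T * real (Suc i) / real n) \<omega> - W (T * real i / real n) \<omega>"
      have walk: "symmetric_walk M ?X n" by (rule wiener_grid_walk[OF W T n])
      have X: "distributed M lborel (?X i) (normal_density 0 (sqrt (T / real n)))" for i
        using wiener_increment_distributed[OF W, of "T * real i / real n" "T * real (Suc i) / real n"] T n
        by (simp add: field_simps)
      have step: "\<P>(\<omega> in M. y - x \<le> \<bar>?X i \<omega>\<bar>) \<le> exp (- c * real n)" for i
        using prob_abs_ge_normal_le[OF X, of "y - x" i] T n y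
        by (simp add: c_def power_divide field_simps)
      have "measure M {\<omega>\<in>space M. \<exists>i<n. y - x \<le> \<bar>?X i \<omega>\<bar>} =
          measure M (\<Union>i<n. {\<omega>\<in>space M. y - x \<le> \<bar>?X i \<omega>\<bar>})"
        by (rule arg_cong[where f="measure M"]) auto
      also have "\<dots> \<le> (\<Sum>i<n. \<P>(\<omega> in M. y - x \<le> \<bar>?X i \<omega>\<bar>))"
      proof (rule finite_measure_subadditive_finite)
        have [measurable]: "?X i \<in> borel_measurable M" for i
          using distributed_measurable[OF X] by simp
        have "{\<omega>\<in>space M. y - x \<le> \<bar>?X i \<omega>\<bar>} \<in> events" for i by measurable
        then show "(\<lambda>i. {\<omega>\<in>space M. y - x \<le> \<bar>?X i \<omega>\<bar>}) ` {..<n} \<subseteq> events" by blast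
      qed simp
      also have "\<dots> \<le> (\<Sum>i<n. exp (- c * real n))" by (intro sum_mono step)
      finally have "measure M {\<omega>\<in>space M. \<exists>i<n. y - x \<le> \<bar>?X i \<omega>\<bar>} \<le> real n * exp (- c * real n)"
        by simp
      moreover have "2 * \<P>(\<omega> in M. x + (y - x) \<le> ?D (T * real n / real n) \<omega>) \<le>
          \<P>(\<omega> in M. \<exists>k\<le>n. x \<le> ?D (T * real k / real n) \<omega>) +
          2 * \<P>(\<omega> in M. \<exists>i<n. y - x \<le> \<bar>?X i \<omega>\<bar>)"
        using symmetric_walk.prob_max_ge_ge[OF walk x, of "y - x"] y
        unfolding wiener_walk_eq[OF walk] by simp
      moreover have "\<P>(\<omega> in M. \<exists>k\<le>n. x \<le> ?D (T * real k / real n) \<omega>) \<le> measure M ?A"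
        using grid[OF n] by (intro finite_measure_mono A) blast
      moreover have "\<P>(\<omega> in M. x + (y - x) \<le> ?D (T * real n / real n) \<omega>) = normal_tail (y / sqrt T)"
        using prob_ge_normal[OF WT, of y] T n by simp
      ultimately show ?thesis by linarith
    qed
    then show "\<exists>N. \<forall>n\<ge>N. 2 * normal_tail (y / sqrt T) \<le>
        measure M ?A + 2 * (real n * exp (- c * real n))"
      by (intro exI[of _ 1]) auto
  qed
  have "((\<lambda>y. 2 * normal_tail (y / sqrt T)) \<longlongrightarrow> 2 * normal_tail (x / sqrt T)) (at_right x)"
    using cts filterlim_at_split isContD by blast
  then show "2 * normal_tail (x / sqrt T) \<le> measure M ?A"
    by (rule tendsto_upperbound) (auto simp: lower eventually_at_filter)
qed

section \<open>Sums of Wiener processes\<close>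

text \<open>Turns a running minimum into a running maximum, so that one reflection principle serves
  both terms of the constraint.\<close>

lemma wiener_uminus:
  assumes W: "wiener_process M W"
  shows "wiener_process M (\<lambda>t \<omega>. - W t \<omega>)"
proof -
  interpret prob_space M using W by (simp add: wiener_process_def)
  have eq: "- W t \<omega> - - W s \<omega> = - (W t \<omega> - W s \<omega>)" for t s \<omega> by simp
  have indep: "indep_vars (\<lambda>_. borel) (\<lambda>i \<omega>. - (W (t (Suc i)) \<omega> - W (t i) \<omega>)) {..<n}"
    if "0 \<le> t 0" "\<forall>i<n. t i \<le> t (Suc i)" for n :: nat and t :: "nat \<Rightarrow> real"
  proof (rule indep_vars_compose2[where Y="\<lambda>_. uminus"])
    show "indep_vars (\<lambda>_. borel) (\<lambda>i \<omega>. W (t (Suc i)) \<omega> - W (t i) \<omega>) {..<n}"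
      using W that unfolding wiener_process_def by blast
  qed auto
  have normal: "distributed M lborel (\<lambda>\<omega>. - (W t \<omega> - W s \<omega>)) (normal_density 0 (sqrt (t - s)))"
    if "0 \<le> s" "s < t" for s t
    using that by (intro distributed_normal_uminus wiener_increment_distributed[OF W]) auto
  show ?thesis
    unfolding wiener_process_def eq
  proof (intro conjI allI ballI impI)
    show "AE \<omega> in M. - W 0 \<omega> = 0" using W unfolding wiener_process_def by simp
    show "continuous_on {0..} (\<lambda>t. - W t \<omega>)" if "\<omega> \<in> space M" for \<omega>
      using wiener_continuous[OF W that] by (rule continuous_on_minus)
  qed (use prob_space_axioms indep normal wiener_measurable[OF W] in auto)
qed

text \<open>All variables X i and Y i are shown to be jointly independent: a product event factors
  first between the two families and then within each. Grouping them into pairs with the same index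
  preserves independence, and each sum is a function of its pair.\<close>

lemma (in prob_space) indep_vars_add:
  fixes X Y :: "'i \<Rightarrow> 'a \<Rightarrow> real"
  assumes X: "indep_vars (\<lambda>_. borel) X I" and Y: "indep_vars (\<lambda>_. borel) Y I" and I: "finite I"
    and XY: "indep_var (PiM I (\<lambda>_. borel)) (\<lambda>\<omega>. \<lambda>i\<in>I. X i \<omega>) (PiM I (\<lambda>_. borel)) (\<lambda>\<omega>. \<lambda>i\<in>I. Y i \<omega>)"
  shows "indep_vars (\<lambda>_. borel) (\<lambda>i \<omega>. X i \<omega> + Y i \<omega>) I"
proof (cases "I = {}")
  case True
  then show ?thesis by (simp add: indep_vars_def2 indep_sets_def)
next
  case False
  define U where "U = (\<lambda>(b, i). if b then X i else Y i)"
  let ?K = "(UNIV :: bool set) \<times> I"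
  let ?F = "\<lambda>k. {U k -` A \<inter> space M | A. A \<in> sets borel}"
  have meas: "U k \<in> borel_measurable M" if "k \<in> ?K" for k
    using that X Y by (auto simp: U_def indep_vars_def2)
  \<comment> \<open>Each class contains the whole space and the index set is finite, so the product
    formula for the full intersection suffices.\<close>
  have "indep_sets ?F ?K"
  proof (subst indep_sets_finite)
    show "?K \<noteq> {}" "finite ?K" using False I by auto
    show "?F k \<subseteq> events" if "k \<in> ?K" for k using meas[OF that] by (auto intro: measurable_sets)
    show "space M \<in> ?F k" for k by (auto intro!: exI[of _ UNIV])
    show "\<forall>A\<in>Pi ?K ?F. prob (\<Inter>k\<in>?K. A k) = (\<Prod>k\<in>?K. prob (A k))"
    proof
      fix A assume "A \<in> Pi ?K ?F"
      then have "\<forall>k\<in>?K. \<exists>B. A k = U k -` B \<inter> space M \<and> B \<in> sets borel" by (auto simp: Pi_def)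
      then obtain B where B: "\<And>k. k \<in> ?K \<Longrightarrow> A k = U k -` B k \<inter> space M"
        "\<And>k. k \<in> ?K \<Longrightarrow> B k \<in> sets borel" by (metis bchoice)
      let ?B = "\<lambda>b. PiE I (\<lambda>i. B (b, i))"
      have sets: "?B b \<in> sets (PiM I (\<lambda>_. borel))" for b
        using B(2) I by (intro sets_PiM_I_finite) auto
      have "(\<Inter>k\<in>?K. A k) =
          (\<lambda>\<omega>. (\<lambda>i\<in>I. X i \<omega>, \<lambda>i\<in>I. Y i \<omega>)) -` (?B True \<times> ?B False) \<inter> space M"
      proof -
        have "(\<Inter>k\<in>?K. A k) = (\<Inter>i\<in>I. A (True, i) \<inter> A (False, i))"
          by (auto simp: UNIV_bool)
        also have "\<dots> = (\<Inter>i\<in>I. X i -` B (True, i) \<inter> Y i -` B (False, i) \<inter> space M)"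
          by (intro INF_cong refl) (auto simp: B(1) U_def)
        finally show ?thesis using False by auto
      qed
      then have "prob (\<Inter>k\<in>?K. A k) =
          prob ((\<lambda>\<omega>. \<lambda>i\<in>I. X i \<omega>) -` ?B True \<inter> space M) *
          prob ((\<lambda>\<omega>. \<lambda>i\<in>I. Y i \<omega>) -` ?B False \<inter> space M)"
        using indep_varD[OF XY sets sets] by simp
      also have "(\<lambda>\<omega>. \<lambda>i\<in>I. X i \<omega>) -` ?B True \<inter> space M = (\<Inter>i\<in>I. X i -` B (True, i) \<inter> space M)"
        using False by auto
      also have "prob \<dots> = (\<Prod>i\<in>I. prob (X i -` B (True, i) \<inter> space M))"
        using False I B(2) by (intro indep_varsD_finite[OF X]) auto
      also have "(\<lambda>\<omega>. \<lambda>i\<in>I. Y i \<omega>) -` ?B False \<inter> space M = (\<Inter>i\<in>I. Y i -` B (False, i) \<inter> space M)"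
        using False by auto
      also have "prob \<dots> = (\<Prod>i\<in>I. prob (Y i -` B (False, i) \<inter> space M))"
        using False I B(2) by (intro indep_varsD_finite[OF Y]) auto
      also have "(\<Prod>i\<in>I. prob (X i -` B (True, i) \<inter> space M)) * (\<Prod>i\<in>I. prob (Y i -` B (False, i) \<inter> space M))
          = (\<Prod>b\<in>UNIV. \<Prod>i\<in>I. prob (A (b, i)))"
        by (simp add: UNIV_bool B(1) U_def mult.commute)
      also have "\<dots> = (\<Prod>k\<in>?K. prob (A k))"
        by (simp add: prod.cartesian_product)
      finally show "prob (\<Inter>k\<in>?K. A k) = (\<Prod>k\<in>?K. prob (A k))" .
    qed
  qed
  then have "indep_vars (\<lambda>_. borel) U ?K"
    using meas by (auto simp: indep_vars_def2)
  \<comment> \<open>The blocks \<open>UNIV \<times> {i}\<close> are disjoint and collect X i and Y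
    i.\<close>
  then have "indep_vars (\<lambda>i. PiM (UNIV \<times> {i}) (\<lambda>_. borel)) (\<lambda>i \<omega>. restrict (\<lambda>k. U k \<omega>) (UNIV \<times> {i})) I"
    by (rule indep_vars_restrict) (auto simp: disjoint_family_on_def)
  then have "indep_vars (\<lambda>_. borel) (\<lambda>i \<omega>. (\<lambda>g. g (True, i) + g (False, i))
      (restrict (\<lambda>k. U k \<omega>) (UNIV \<times> {i}))) I"
    by (rule indep_vars_compose2) (intro borel_measurable_add measurable_component_singleton; simp)
  then show ?thesis by (simp add: U_def)
qed

text \<open>Independence of whole paths is pushed through measurable maps to single increments and
  to finite vectors of increments. Variances add, and \<open>sqrt 2\<close> restores the
  normalisation.\<close>

lemma wiener_sum:
  assumes V: "wiener_process M V" and W: "wiener_process M W" and VW: "indep_processes M V W"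
  shows "wiener_process M (\<lambda>t \<omega>. (V t \<omega> + W t \<omega>) / sqrt 2)"
proof -
  interpret prob_space M using W by (simp add: wiener_process_def)
  let ?N = "PiM {0..} (\<lambda>_. borel) :: (real \<Rightarrow> real) measure"
  have VW: "indep_var ?N (\<lambda>\<omega>. \<lambda>t\<in>{0..}. V t \<omega>) ?N (\<lambda>\<omega>. \<lambda>t\<in>{0..}. W t \<omega>)"
    using VW by (simp add: indep_processes_def)
  have eq: "(V t \<omega> + W t \<omega>) / sqrt 2 - (V s \<omega> + W s \<omega>) / sqrt 2 =
      ((V t \<omega> - V s \<omega>) + (W t \<omega> - W s \<omega>)) / sqrt 2" for s t \<omega>
    by (simp add: field_simps)
  have proj: "(\<lambda>f. f t - f s) \<in> borel_measurable ?N" if "0 \<le> s" "0 \<le> t" for s t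
    using that by (intro borel_measurable_diff measurable_component_singleton) auto
  have normal: "distributed M lborel (\<lambda>\<omega>. ((V t \<omega> - V s \<omega>) + (W t \<omega> - W s \<omega>)) / sqrt 2)
      (normal_density 0 (sqrt (t - s)))" if st: "0 \<le> s" "s < t" for s t
  proof -
    have "0 \<le> t" using st by simp
    have "indep_var borel ((\<lambda>f. f t - f s) \<circ> (\<lambda>\<omega>. \<lambda>t\<in>{0..}. V t \<omega>))
        borel ((\<lambda>f. f t - f s) \<circ> (\<lambda>\<omega>. \<lambda>t\<in>{0..}. W t \<omega>))"
      using st by (intro indep_var_compose[OF VW] proj) auto
    then have "indep_var borel (\<lambda>\<omega>. V t \<omega> - V s \<omega>) borel (\<lambda>\<omega>. W t \<omega> - W s \<omega>)"
      using st \<open>0 \<le> t\<close> by (simp add: comp_def)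
    then have "distributed M lborel (\<lambda>\<omega>. (V t \<omega> - V s \<omega>) + (W t \<omega> - W s \<omega>))
        (normal_density (0 + 0) (sqrt ((sqrt (t - s))\<^sup>2 + (sqrt (t - s))\<^sup>2)))"
      using st by (intro add_indep_normal wiener_increment_distributed V W) auto
    then have "distributed M lborel (\<lambda>\<omega>. 0 + (1 / sqrt 2) * ((V t \<omega> - V s \<omega>) + (W t \<omega> - W s \<omega>)))
        (normal_density (0 + (1 / sqrt 2) * (0 + 0))
          (\<bar>1 / sqrt 2\<bar> * sqrt ((sqrt (t - s))\<^sup>2 + (sqrt (t - s))\<^sup>2)))"
      by (rule normal_density_affine) (use st in auto)
    moreover have "\<bar>1 / sqrt 2\<bar> * sqrt ((sqrt (t - s))\<^sup>2 + (sqrt (t - s))\<^sup>2) = sqrt (t - s)"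
      using st by (simp add: real_sqrt_mult[symmetric] real_sqrt_divide[symmetric])
    ultimately show ?thesis by simp
  qed
  have indep: "indep_vars (\<lambda>_. borel)
      (\<lambda>i \<omega>. ((V (t (Suc i)) \<omega> - V (t i) \<omega>) + (W (t (Suc i)) \<omega> - W (t i) \<omega>)) / sqrt 2) {..<n}"
    if t: "0 \<le> t 0" "\<forall>i<n. t i \<le> t (Suc i)" for n :: nat and t :: "nat \<Rightarrow> real"
  proof (rule indep_vars_compose2[where Y="\<lambda>_ x. x / sqrt 2"])
    \<comment> \<open>Paths are restricted to \<open>{0..}\<close> and \<open>undefined\<close>
      elsewhere, so their increments agree with those of V and W only at nonnegative times.\<close>
    have nonneg: "0 \<le> t i" if "i \<le> n" for i
      using that by (induction i) (use t in \<open>auto intro: order_trans\<close>)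
    let ?P = "\<lambda>f. \<lambda>i\<in>{..<n}. f (t (Suc i)) - f (t i)"
    have "?P \<in> measurable ?N (PiM {..<n} (\<lambda>_. borel))"
      by (intro measurable_restrict proj nonneg) auto
    then have "indep_var (PiM {..<n} (\<lambda>_. borel)) (?P \<circ> (\<lambda>\<omega>. \<lambda>t\<in>{0..}. V t \<omega>))
        (PiM {..<n} (\<lambda>_. borel)) (?P \<circ> (\<lambda>\<omega>. \<lambda>t\<in>{0..}. W t \<omega>))"
      by (intro indep_var_compose[OF VW])
    moreover have "?P \<circ> (\<lambda>\<omega>. \<lambda>t\<in>{0..}. V t \<omega>) = (\<lambda>\<omega>. \<lambda>i\<in>{..<n}. V (t (Suc i)) \<omega> - V (t i) \<omega>)"
      "?P \<circ> (\<lambda>\<omega>. \<lambda>t\<in>{0..}. W t \<omega>) = (\<lambda>\<omega>. \<lambda>i\<in>{..<n}. W (t (Suc i)) \<omega> - W (t i) \<omega>)"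
      using nonneg by (auto simp: fun_eq_iff restrict_def)
    ultimately have VW': "indep_var (PiM {..<n} (\<lambda>_. borel)) (\<lambda>\<omega>. \<lambda>i\<in>{..<n}. V (t (Suc i)) \<omega> - V (t i) \<omega>)
        (PiM {..<n} (\<lambda>_. borel)) (\<lambda>\<omega>. \<lambda>i\<in>{..<n}. W (t (Suc i)) \<omega> - W (t i) \<omega>)"
      by simp
    show "indep_vars (\<lambda>_. borel)
        (\<lambda>i \<omega>. (V (t (Suc i)) \<omega> - V (t i) \<omega>) + (W (t (Suc i)) \<omega> - W (t i) \<omega>)) {..<n}"
    proof (rule indep_vars_add[OF _ _ _ VW'])
      show "indep_vars (\<lambda>_. borel) (\<lambda>i \<omega>. V (t (Suc i)) \<omega> - V (t i) \<omega>) {..<n}"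
        using V t unfolding wiener_process_def by blast
      show "indep_vars (\<lambda>_. borel) (\<lambda>i \<omega>. W (t (Suc i)) \<omega> - W (t i) \<omega>) {..<n}"
        using W t unfolding wiener_process_def by blast
    qed simp
  qed simp
  show ?thesis
    unfolding wiener_process_def eq
  proof (intro conjI allI ballI impI)
    have "AE \<omega> in M. V 0 \<omega> = 0" "AE \<omega> in M. W 0 \<omega> = 0"
      using V W unfolding wiener_process_def by auto
    then show "AE \<omega> in M. (V 0 \<omega> + W 0 \<omega>) / sqrt 2 = 0" by eventually_elim simp
    show "continuous_on {0..} (\<lambda>t. (V t \<omega> + W t \<omega>) / sqrt 2)" if "\<omega> \<in> space M" for \<omega>
      by (intro continuous_intros wiener_continuous[OF V that] wiener_continuous[OF W that]) auto
    show "(\<lambda>\<omega>. (V t \<omega> + W t \<omega>) / sqrt 2) \<in> borel_measurable M" if "0 \<le> t" for t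
      using wiener_measurable[OF V that] wiener_measurable[OF W that] by measurable
  qed (use prob_space_axioms indep normal in auto)
qed

section \<open>The optimal battery capacity\<close>

text \<open>The process starts at 0, so a level u \<le> 0 is reached with certainty, whereas the
  reflection formula would exceed 1 for u < 0.\<close>

definition max_tail :: "real \<Rightarrow> real \<Rightarrow> real" where
  "max_tail v u = (if u \<le> 0 then 1 else 2 * normal_tail (u / v))"

text \<open>The representation of f holds only almost surely, so the events for f and W are compared
  up to a null set. Both must be measurable, which for f follows from continuity of its own
  paths.\<close>

lemma prob_scaled_wiener_exceeds:
  assumes W: "wiener_process M W" and T: "0 < T" and s: "0 < s"
    and f: "\<And>t. t \<in> {0..T} \<Longrightarrow> f t \<in> borel_measurable M"
    and cont: "\<And>\<omega>. \<omega> \<in> space M \<Longrightarrow> continuous_on {0..T} (\<lambda>t. f t \<omega>)"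
    and AE: "AE \<omega> in M. \<forall>t\<in>{0..T}. f t \<omega> = c + s * (W t \<omega> - W 0 \<omega>)"
  shows "\<P>(\<omega> in M. \<exists>t\<in>{0..T}. y \<le> f t \<omega>) = max_tail (s * sqrt T) (y - c)"
proof -
  interpret prob_space M using W by (simp add: wiener_process_def)
  let ?D = "\<lambda>t \<omega>. W t \<omega> - W 0 \<omega>" and ?x = "(y - c) / s"
  have D: "?D t \<in> borel_measurable M" if "t \<in> {0..T}" for t
    using that by (intro borel_measurable_diff wiener_measurable[OF W]) auto
  have contD: "continuous_on {0..T} (\<lambda>t. ?D t \<omega>)" if "\<omega> \<in> space M" for \<omega>
    using that by (intro continuous_on_diff continuous_on_const
      continuous_on_subset[OF wiener_continuous[OF W]]) auto
  have "\<P>(\<omega> in M. \<exists>t\<in>{0..T}. y \<le> f t \<omega>) = \<P>(\<omega> in M. \<exists>t\<in>{0..T}. ?x \<le> ?D t \<omega>)"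
  proof (rule finite_measure_eq_AE)
    show "AE \<omega> in M. \<omega> \<in> {\<omega>\<in>space M. \<exists>t\<in>{0..T}. y \<le> f t \<omega>} \<longleftrightarrow>
        \<omega> \<in> {\<omega>\<in>space M. \<exists>t\<in>{0..T}. ?x \<le> ?D t \<omega>}"
      using AE
    proof eventually_elim
      case (elim \<omega>)
      have "y \<le> f t \<omega> \<longleftrightarrow> ?x \<le> ?D t \<omega>" if "t \<in> {0..T}" for t
      proof -
        have "f t \<omega> = c + s * ?D t \<omega>" using elim that by blast
        then have "y \<le> f t \<omega> \<longleftrightarrow> y - c \<le> ?D t \<omega> * s"
          by (simp add: mult.commute diff_le_eq add.commute)
        then show ?thesis using s by (simp only: pos_divide_le_eq)
      qed
      then show ?case by blast
    qed
  qed (rule path_exceeds_event[OF f cont T] path_exceeds_event[OF D contD T]; assumption)+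
  also have "\<dots> = max_tail (s * sqrt T) (y - c)"
  proof (cases "y - c \<le> 0")
    case True
    then have "?x \<le> ?D 0 \<omega>" for \<omega> using s by (simp add: field_simps)
    then have "{\<omega>\<in>space M. \<exists>t\<in>{0..T}. ?x \<le> ?D t \<omega>} = space M" using T by force
    then show ?thesis using True by (simp add: max_tail_def prob_space)
  next
    case False
    then show ?thesis using wiener_reflection[OF W T, of ?x] s by (simp add: max_tail_def)
  qed
  finally show ?thesis .
qed

section \<open>From the energy process to a constraint on two real numbers\<close>

lemma le_SUP_Icc_iff:
  fixes g :: "real \<Rightarrow> real"
  assumes g: "continuous_on {a..b} g" and "a \<le> b"
  shows "y \<le> (SUP t\<in>{a..b}. g t) \<longleftrightarrow> (\<exists>t\<in>{a..b}. y \<le> g t)"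
proof -
  obtain t where t: "t \<in> {a..b}" "\<And>s. s \<in> {a..b} \<Longrightarrow> g s \<le> g t"
    using continuous_attains_sup[OF compact_Icc _ g] \<open>a \<le> b\<close> by force
  then have "(SUP t\<in>{a..b}. g t) = g t" by (intro cSup_eq_maximum) auto
  then show ?thesis using t order_trans by metis
qed

lemma INF_Icc_le_iff:
  fixes g :: "real \<Rightarrow> real"
  assumes g: "continuous_on {a..b} g" and "a \<le> b"
  shows "(INF t\<in>{a..b}. g t) \<le> y \<longleftrightarrow> (\<exists>t\<in>{a..b}. g t \<le> y)"
proof -
  obtain t where t: "t \<in> {a..b}" "\<And>s. s \<in> {a..b} \<Longrightarrow> g t \<le> g s"
    using continuous_attains_inf[OF compact_Icc _ g] \<open>a \<le> b\<close> by force
  then have "(INF t\<in>{a..b}. g t) = g t" by (intro cInf_eq_minimum) auto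
  then show ?thesis using t order_trans by metis
qed

text \<open>The arguments of \<open>max_tail\<close> are the distances from the starting level 2
  \<alpha> N B to the upper threshold 2 N B - \<beta> and to the lower threshold \<beta>.\<close>

definition tail_feasible :: "real \<Rightarrow> real \<Rightarrow> real \<Rightarrow> real \<Rightarrow> real \<Rightarrow> real \<Rightarrow> bool" where
  "tail_feasible v B \<beta> \<delta> \<alpha> N \<longleftrightarrow> 0 \<le> N \<and> 0 \<le> \<alpha> \<and> \<alpha> \<le> 1 \<and>
    max_tail v (2 * N * B - \<beta> - 2 * \<alpha> * N * B) + max_tail v (2 * \<alpha> * N * B - \<beta>) \<le> \<delta>"

text \<open>The power-flow integrals enter the two energies with opposite signs and cancel, leaving
  \<sigma> (W1 + W2) = sqrt 2 \<sigma> V.\<close>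

lemma feasible_total_energy_iff:
  assumes W1: "wiener_process M W1" and W2: "wiener_process M W2" and indep: "indep_processes M W1 W2"
    and \<sigma>: "0 < \<sigma>" and Tf: "0 < Tf"
    and X: "\<And>N \<alpha>. microgrid_energies M \<sigma> Bmax P12 Tf W1 W2 N \<alpha> (X1 N \<alpha>) (X2 N \<alpha>)"
  shows "feasible M Bmax Tf \<beta> \<delta>' (\<lambda>N \<alpha>. total_energy (X1 N \<alpha>) (X2 N \<alpha>)) (\<alpha>, N) \<longleftrightarrow>
    tail_feasible (sqrt 2 * \<sigma> * sqrt Tf) Bmax \<beta> \<delta>' \<alpha> N"
proof -
  define V where "V t \<omega> = (W1 t \<omega> + W2 t \<omega>) / sqrt 2" for t \<omega>
  have V: "wiener_process M V"
    unfolding V_def[abs_def] by (rule wiener_sum[OF W1 W2 indep])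
  interpret prob_space M using V by (simp add: wiener_process_def)
  let ?X = "total_energy (X1 N \<alpha>) (X2 N \<alpha>)"
  have meas: "?X t \<in> borel_measurable M" if "t \<in> {0..Tf}" for t
    using X[of N \<alpha>] that unfolding microgrid_energies_def total_energy_def[abs_def]
    by (auto intro: borel_measurable_add)
  have cont: "continuous_on {0..Tf} (\<lambda>t. ?X t \<omega>)" if "\<omega> \<in> space M" for \<omega>
    using X[of N \<alpha>] that unfolding microgrid_energies_def total_energy_def[abs_def]
    by (auto intro: continuous_on_add)
  have AE: "AE \<omega> in M. \<forall>t\<in>{0..Tf}.
      ?X t \<omega> = 2 * \<alpha> * N * Bmax + sqrt 2 * \<sigma> * (V t \<omega> - V 0 \<omega>)"
  proof -
    have "AE \<omega> in M. W1 0 \<omega> = 0" "AE \<omega> in M. W2 0 \<omega> = 0"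
      using W1 W2 unfolding wiener_process_def by auto
    moreover have "AE \<omega> in M. \<forall>t\<in>{0..Tf}. ?X t \<omega> = 2 * \<alpha> * N * Bmax + \<sigma> * (W1 t \<omega> + W2 t \<omega>)"
      using conjunct2[OF conjunct2[OF X[of N \<alpha>, unfolded microgrid_energies_def]]]
      by eventually_elim (simp add: total_energy_def distrib_left)
    ultimately show ?thesis
      by eventually_elim (simp add: V_def)
  qed
  \<comment> \<open>The infimum is at most \<beta> exactly when the negated process, driven by -V,
    reaches -\<beta>.\<close>
  have "\<P>(\<omega> in M. \<exists>t\<in>{0..Tf}. - \<beta> \<le> - ?X t \<omega>) =
      max_tail (sqrt 2 * \<sigma> * sqrt Tf) (- \<beta> - - (2 * \<alpha> * N * Bmax))"
  proof (rule prob_scaled_wiener_exceeds[OF wiener_uminus[OF V] Tf])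
    show "AE \<omega> in M. \<forall>t\<in>{0..Tf}. - ?X t \<omega> =
        - (2 * \<alpha> * N * Bmax) + sqrt 2 * \<sigma> * (- V t \<omega> - - V 0 \<omega>)"
      using AE by eventually_elim (simp add: algebra_simps)
  qed (use \<sigma> meas cont in \<open>auto intro: continuous_on_minus\<close>)
  moreover have "{\<omega>\<in>space M. (INF t\<in>{0..Tf}. ?X t \<omega>) \<le> \<beta>} = {\<omega>\<in>space M. \<exists>t\<in>{0..Tf}. - \<beta> \<le> - ?X t \<omega>}"
    using INF_Icc_le_iff[OF cont] Tf by (intro Collect_cong conj_cong refl) simp
  moreover have "\<P>(\<omega> in M. \<exists>t\<in>{0..Tf}. 2 * N * Bmax - \<beta> \<le> ?X t \<omega>) =
      max_tail (sqrt 2 * \<sigma> * sqrt Tf) (2 * N * Bmax - \<beta> - 2 * \<alpha> * N * Bmax)"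
    using \<sigma> by (intro prob_scaled_wiener_exceeds[OF V Tf _ meas cont AE]) simp
  moreover have "{\<omega>\<in>space M. 2 * N * Bmax - \<beta> \<le> (SUP t\<in>{0..Tf}. ?X t \<omega>)} =
      {\<omega>\<in>space M. \<exists>t\<in>{0..Tf}. 2 * N * Bmax - \<beta> \<le> ?X t \<omega>}"
    using le_SUP_Icc_iff[OF cont] Tf by (intro Collect_cong conj_cong refl) simp
  ultimately show ?thesis by (simp add: feasible_def tail_feasible_def)
qed

text \<open>By strict convexity of the tail, moving \<open>\<alpha>\<close> to \<open>1 / 2\<close> makes the constraint slack, and a slack
  constraint allows a smaller \<open>N\<close>.\<close>

lemma tail_feasible_optimum:
  assumes v: "0 < v" and B: "0 < B" and \<beta>: "0 \<le> \<beta>" and \<delta>: "0 < \<delta>" "\<delta> < 1"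
    and feas: "tail_feasible v B \<beta> \<delta> \<alpha> N" and min: "\<And>\<alpha>' N'. tail_feasible v B \<beta> \<delta> \<alpha>' N' \<Longrightarrow> N \<le> N'"
  shows "N \<le> (v * sqrt (2 * ln (2 / \<delta>)) + \<beta>) / B" and "\<alpha> = 1 / 2"
proof -
  \<comment> \<open>At \<alpha> = 1/2 both margins equal N' B - \<beta>, so the two terms merge into
    four tails.\<close>
  have half: "tail_feasible v B \<beta> \<delta> (1 / 2) N'" if "0 < N' * B - \<beta>" "4 * normal_tail ((N' * B - \<beta>) / v) \<le> \<delta>" for N'
  proof -
    have "0 < N' * B" using that(1) \<beta> by simp
    then have N': "0 < N'" using B by (simp add: zero_less_mult_iff)
    have eq: "2 * N' * B - \<beta> - 2 * (1 / 2) * N' * B = N' * B - \<beta>"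
      "2 * (1 / 2) * N' * B - \<beta> = N' * B - \<beta>" by (simp_all add: algebra_simps)
    show ?thesis unfolding tail_feasible_def eq using that N' by (simp add: max_tail_def)
  qed
  show "N \<le> (v * sqrt (2 * ln (2 / \<delta>)) + \<beta>) / B"
  proof (rule min[OF half])
    \<comment> \<open>Chosen so that 2 exp(- r^2 / 2) = \<delta>.\<close>
    let ?r = "sqrt (2 * ln (2 / \<delta>))"
    have ln: "0 < ln (2 / \<delta>)" using \<delta> by (intro ln_gt_zero) (simp add: field_simps)
    have eq: "(v * ?r + \<beta>) / B * B - \<beta> = v * ?r" using B by simp
    show "0 < (v * ?r + \<beta>) / B * B - \<beta>" unfolding eq using v ln by simp
    have "normal_tail ?r \<le> exp (- ?r\<^sup>2 / 2) / 2" using ln by (intro normal_tail_le_exp) simp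
    also have "\<dots> = \<delta> / 4" using ln \<delta> by (simp add: exp_minus)
    finally show "4 * normal_tail (((v * ?r + \<beta>) / B * B - \<beta>) / v) \<le> \<delta>"
      unfolding eq using v by simp
  qed
  show "\<alpha> = 1 / 2"
  proof (rule ccontr)
    assume \<alpha>: "\<alpha> \<noteq> 1 / 2"
    define a b where "a = 2 * N * B - \<beta> - 2 * \<alpha> * N * B" and "b = 2 * \<alpha> * N * B - \<beta>"
    have le: "max_tail v a + max_tail v b \<le> \<delta>" using feas by (simp add: tail_feasible_def a_def b_def)
    have nonneg: "0 \<le> max_tail v u" for u by (simp add: max_tail_def normal_tail_nonneg)
    \<comment> \<open>A margin that is not positive would contribute 1 > \<delta> by itself.\<close>
    have pos: "0 < a" "0 < b"
      using le \<delta> nonneg[of a] nonneg[of b] by (auto simp: max_tail_def split: if_splits)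
    have mid: "(a + b) / 2 = N * B - \<beta>" by (simp add: a_def b_def field_simps)
    \<comment> \<open>N = 0 would give b = -\<beta> \<le> 0. With N nonzero, \<alpha> \<noteq> 1/2
      makes the margins differ, as strict convexity requires.\<close>
    have "N \<noteq> 0" using pos \<beta> by (auto simp: b_def)
    have "a - b = 2 * N * B * (1 - 2 * \<alpha>)" by (simp add: a_def b_def algebra_simps)
    then have "a \<noteq> b" using \<open>N \<noteq> 0\<close> B \<alpha> by auto
    have "2 * normal_tail ((N * B - \<beta>) / v) < normal_tail (a / v) + normal_tail (b / v)"
    proof -
      have "2 * normal_tail ((a / v + b / v) / 2) < normal_tail (a / v) + normal_tail (b / v)"
      proof (cases "a < b")
        case True
        then show ?thesis
          using pos v by (intro normal_tail_strict_midpoint_convex) (auto simp: divide_strict_right_mono)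
      next
        case False
        then show ?thesis
          using normal_tail_strict_midpoint_convex[of "b / v" "a / v"] pos v \<open>a \<noteq> b\<close>
          by (simp add: divide_strict_right_mono add.commute)
      qed
      moreover have "(a / v + b / v) / 2 = (N * B - \<beta>) / v"
        unfolding mid[symmetric] by (simp add: add_divide_distrib mult.commute)
      ultimately show ?thesis by simp
    qed
    then have slack: "4 * normal_tail ((N * B - \<beta>) / v) < \<delta>"
      using le pos by (simp add: max_tail_def)
    have "isCont (\<lambda>N'. 4 * normal_tail ((N' * B - \<beta>) / v)) N"
      by (intro continuous_intros isCont_o2[OF _ isCont_normal_tail]) (use v in auto)
    then have "((\<lambda>N'. 4 * normal_tail ((N' * B - \<beta>) / v)) \<longlongrightarrow> 4 * normal_tail ((N * B - \<beta>) / v)) (at_left N)"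
      using filterlim_at_split isContD by blast
    then have "eventually (\<lambda>N'. 4 * normal_tail ((N' * B - \<beta>) / v) < \<delta>) (at_left N)"
      using slack by (rule order_tendstoD)
    moreover have "eventually (\<lambda>N'. 0 < N' * B - \<beta>) (at_left N)"
    proof (rule order_tendstoD)
      show "((\<lambda>N'. N' * B - \<beta>) \<longlongrightarrow> N * B - \<beta>) (at_left N)" by (intro tendsto_intros)
      show "0 < N * B - \<beta>" unfolding mid[symmetric] using pos by simp
    qed
    moreover have "eventually (\<lambda>N'. N' < N) (at_left N)" by (simp add: eventually_at_filter)
    ultimately have "eventually (\<lambda>N'. tail_feasible v B \<beta> \<delta> (1 / 2) N' \<and> N' < N) (at_left N)"
      by eventually_elim (simp add: half)
    then obtain N' where "tail_feasible v B \<beta> \<delta> (1 / 2) N'" "N' < N"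
      using eventually_happens trivial_limit_at_left_real by blast
    then show False using min by fastforce
  qed
qed

theorem mainTheorem5:
  fixes M :: "'a measure"
    and W1 W2 :: "real \<Rightarrow> 'a \<Rightarrow> real"
    and X1 X2 :: "real \<Rightarrow> real \<Rightarrow> real \<Rightarrow> 'a \<Rightarrow> real"
    and \<sigma> Bmax P12 \<delta> Tf \<delta>' \<sigma>c \<beta> N0 \<alpha>0 Nc \<alpha>c :: real
  assumes "wiener_process M W1" "wiener_process M W2" "indep_processes M W1 W2"
    and "\<sigma> > 0" "Bmax > 0" "P12 \<ge> 0" "0 < \<delta>" "\<delta> < 1" "Tf > 0"
    and "\<delta>' = \<delta> / 2" "\<sigma>c = sqrt 2 * \<sigma>"
    and "\<And>N \<alpha>. microgrid_energies M \<sigma> Bmax P12 Tf W1 W2 N \<alpha> (X1 N \<alpha>) (X2 N \<alpha>)"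
    and "\<beta> \<ge> 0"
    (* the law of the energy difference does not depend on the pair (N0, \<alpha>0) *)
    and "\<P>(\<omega> in M. (SUP t\<in>{0..Tf}. \<bar>energy_difference (X1 N0 \<alpha>0) (X2 N0 \<alpha>0) t \<omega>\<bar>) \<ge> \<beta>) < \<delta> / 2"
    and "is_arg_min (\<lambda>(\<alpha>, N). N)
           (feasible M Bmax Tf \<beta> \<delta>' (\<lambda>N \<alpha>. total_energy (X1 N \<alpha>) (X2 N \<alpha>))) (\<alpha>c, Nc)"
  shows "Nc \<le> sqrt (8 * \<sigma>c\<^sup>2 * Tf * ln (2 / \<delta>')) / (2 * Bmax) + \<beta> / Bmax \<and> \<alpha>c = 1 / 2"
proof -
  let ?v = "sqrt 2 * \<sigma> * sqrt Tf"
  note feasible_iff = feasible_total_energy_iff[OF assms(1-4,9,12)]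
  have v: "0 < ?v" using assms(4,9) by simp
  have \<delta>': "0 < \<delta>'" "\<delta>' < 1" using assms(7,8,10) by auto
  have "is_arg_min (\<lambda>(\<alpha>, N). N) (\<lambda>(\<alpha>, N). tail_feasible ?v Bmax \<beta> \<delta>' \<alpha> N) (\<alpha>c, Nc)"
    using assms(15) by (simp add: is_arg_min_def feasible_iff)
  then have "tail_feasible ?v Bmax \<beta> \<delta>' \<alpha>c Nc"
    and "\<And>\<alpha> N. tail_feasible ?v Bmax \<beta> \<delta>' \<alpha> N \<Longrightarrow> Nc \<le> N"
    by (auto simp: is_arg_min_def not_less)
  note optimum = tail_feasible_optimum[OF v assms(5,13) \<delta>' this]
  \<comment> \<open>Here v = \<sigma>c sqrt Tf, so 8 \<sigma>c^2 Tf = 8 v^2; splitting 8 as 4 times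
    2 lets the root 2 v cancel the 2 in \<open>2 * Bmax\<close>.\<close>
  have "8 * \<sigma>c\<^sup>2 * Tf * ln (2 / \<delta>') = (2 * ?v)\<^sup>2 * (2 * ln (2 / \<delta>'))"
    using assms(9,11) by (simp add: power_mult_distrib)
  then have "sqrt (8 * \<sigma>c\<^sup>2 * Tf * ln (2 / \<delta>')) = 2 * ?v * sqrt (2 * ln (2 / \<delta>'))"
    using v by (simp only: real_sqrt_mult real_sqrt_abs abs_of_pos)
  then have "sqrt (8 * \<sigma>c\<^sup>2 * Tf * ln (2 / \<delta>')) / (2 * Bmax) + \<beta> / Bmax =
      (?v * sqrt (2 * ln (2 / \<delta>')) + \<beta>) / Bmax"
    by (simp add: add_divide_distrib)
  with optimum show ?thesis by simp
qed

end
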